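(* Let $k \geq 3$ be an integer and let $G$ be a graph on $n \geq 2^{2k}$ vertices. Then either $G$ contains no even $k$-vertex subgraph or else $G$ contains at least $$\frac{1}{2^{2k^2+1}k^2n^2}\binom{n}{k}$$ even $k$-vertex subgraphs.
   Context: All graphs are finite and simple. An even $k$-vertex subgraph of $G$ is an induced subgraph $G[U]$, with $U\subseteq V(G)$ and $|U|=k$, having an even number of edges; such subgraphs are counted by their vertex sets $U$. *)

theory Defs imports Complex_Main begin

text \<open>A finite simple graph with vertex set \<open>V\<close> and edge set \<open>E\<close>; an edge is the
  two-element set of its endpoints.\<close>

definition finite_simple_graph :: "'a set \<Rightarrow> 'a set set \<Rightarrow> bool" where
  "finite_simple_graph V E \<longleftrightarrow> finite V \<and> (\<forall>e\<in>E. e \<subseteq> V \<and> card e = 2)"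

definition induced_edges :: "'a set set \<Rightarrow> 'a set \<Rightarrow> 'a set set" where
  "induced_edges E U = {e \<in> E. e \<subseteq> U}"

text \<open>Even induced subgraphs are identified with, and counted by, their vertex sets.\<close>

definition even_subgraphs :: "'a set \<Rightarrow> 'a set set \<Rightarrow> nat \<Rightarrow> 'a set set" where
  "even_subgraphs V E k =
     {U. U \<subseteq> V \<and> card U = k \<and> even (card (induced_edges E U))}"

end

theory Submission imports Defs begin

text \<open>
  The parity of the number of edges induced by a vertex set \<open>U\<close> is a quadratic polynomial over the
  field with two elements in the indicator variables of \<open>U\<close>, so its third differences vanish:
  if three vertices of \<open>U\<close> may each be exchanged for a private substitute, then the eight
  resulting edge counts have an even sum (\<open>even_third_difference\<close>).

  Suppose that some even \<open>k\<close>-set exists and let \<open>W\<close> be any \<open>k\<close>-set. Choose an even \<open>k\<close>-set \<open>U\<close> for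
  which \<open>U - W\<close> is as small as possible. If \<open>U - W\<close> had three elements, they could be exchanged for
  three elements of \<open>W - U\<close>. The seven nontrivial exchanges come closer to \<open>W\<close>, so all of them
  are odd; with \<open>U\<close> even, the sum of the eight counts would be odd. Hence every \<open>k\<close>-set is obtained
  from some even \<open>k\<close>-set by replacing at most two vertices (\<open>even_subgraph_near\<close>). Each even
  \<open>k\<close>-set reaches at most \<open>k\<^sup>2 n\<^sup>2\<close> sets in this way, so there are at least
  \<open>(n choose k) / (k\<^sup>2 n\<^sup>2)\<close> even ones, which is more than the theorem asks for.
\<close>

lemma card_induced_edges_eq_sum:
  assumes "finite E"
  shows "card (induced_edges E U) = (\<Sum>e\<in>E. of_bool (e \<subseteq> U))"
  using assms by (simp add: induced_edges_def of_bool_def flip: sum.inter_filter)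

text \<open>
  A two-element edge meets at most two of the three exchange pairs. Exchanging within a pair that it
  misses does not affect whether it is induced, so it is counted an even number of times.
\<close>

lemma even_third_difference:
  fixes E :: "'a set set"
  defines "d \<equiv> \<lambda>U. card (induced_edges E U)"
  assumes "finite E" and card2: "\<And>e. e \<in> E \<Longrightarrow> card e = 2"
    and disj: "{x, a} \<inter> {y, b} = {}" "{x, a} \<inter> {z, c} = {}" "{y, b} \<inter> {z, c} = {}"
  shows "even (d (T \<union> {x, y, z}) + d (T \<union> {a, y, z}) + d (T \<union> {x, b, z}) + d (T \<union> {x, y, c})
             + d (T \<union> {a, b, z}) + d (T \<union> {a, y, c}) + d (T \<union> {x, b, c}) + d (T \<union> {a, b, c}))"
proof -
  define i :: "'a set \<Rightarrow> 'a \<Rightarrow> 'a \<Rightarrow> 'a \<Rightarrow> nat" where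
    "i e u v w = of_bool (e \<subseteq> T \<union> {u, v, w})" for e u v w
  have "even (i e x y z + i e a y z + i e x b z + i e x y c + i e a b z + i e a y c + i e x b c + i e a b c)"
    if eE: "e \<in> E" for e
  proof -
    obtain p q where e: "e = {p, q}"
      using card2[OF eE] by (auto simp: card_2_iff)
    consider "e \<inter> {x, a} = {}" | "e \<inter> {y, b} = {}" | "e \<inter> {z, c} = {}"
      using disj unfolding e by blast
    then show ?thesis
    proof cases
      case 1
      then have "i e x v w = i e a v w" for v w
        unfolding i_def by (intro arg_cong[where f = of_bool]) blast
      then show ?thesis by simp blast
    next
      case 2
      then have "i e u y w = i e u b w" for u w
        unfolding i_def by (intro arg_cong[where f = of_bool]) blast
      then show ?thesis by simp blast
    next
      case 3
      then have "i e u v z = i e u v c" for u v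
        unfolding i_def by (intro arg_cong[where f = of_bool]) blast
      then show ?thesis by simp blast
    qed
  qed
  then have "even (\<Sum>e\<in>E. i e x y z + i e a y z + i e x b z + i e x y c
                       + i e a b z + i e a y c + i e x b c + i e a b c)"
    by (rule dvd_sum)
  then show ?thesis
    unfolding d_def card_induced_edges_eq_sum[OF \<open>finite E\<close>] i_def by (simp only: sum.distrib)
qed

lemma obtain_three_distinct:
  assumes "3 \<le> card A"
  obtains x y z where "{x, y, z} \<subseteq> A" "x \<noteq> y" "x \<noteq> z" "y \<noteq> z"
proof -
  obtain B where "B \<subseteq> A" "card B = 3"
    using obtain_subset_with_card_n[OF assms] by blast
  then show ?thesis
    using that by (auto simp: card_3_iff)
qed

text \<open>
  If an even \<open>U\<close> that is as close to \<open>W\<close> as possible had three vertices outside \<open>W\<close>, they could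
  be exchanged for three of \<open>W - U\<close>. By minimality all exchanges but the trivial one would give an odd
  set, which contradicts \<open>even_third_difference\<close>.
\<close>

lemma even_subgraph_near:
  assumes G: "finite_simple_graph V E"
    and ne: "even_subgraphs V E k \<noteq> {}"
    and W: "W \<subseteq> V" "card W = k"
  obtains U where "U \<in> even_subgraphs V E k" "card (U - W) \<le> 2"
proof -
  have "finite V" and card2: "\<And>e. e \<in> E \<Longrightarrow> card e = 2"
    using G by (auto simp: finite_simple_graph_def)
  have "E \<subseteq> Pow V"
    using G by (auto simp: finite_simple_graph_def)
  then have "finite E"
    using \<open>finite V\<close> by (meson finite_Pow_iff finite_subset)
  obtain U where U: "U \<in> even_subgraphs V E k"
    and least: "\<And>U'. U' \<in> even_subgraphs V E k \<Longrightarrow> card (U - W) \<le> card (U' - W)"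
    using ne ex_has_least_nat[of "\<lambda>U. U \<in> even_subgraphs V E k" _ "\<lambda>U. card (U - W)"] by blast
  have UV: "U \<subseteq> V" and Uk: "card U = k" and Ue: "even (card (induced_edges E U))"
    using U by (auto simp: even_subgraphs_def)
  have fin: "finite U" "finite W"
    using UV W \<open>finite V\<close> finite_subset by blast+
  have "card (U - W) \<le> 2"
  proof (rule ccontr)
    assume "\<not> card (U - W) \<le> 2"
    then have UW3: "3 \<le> card (U - W)" by simp
    moreover have "card (W - U) = card (U - W)"
      using fin Uk W(2) by (simp add: card_Diff_subset_Int Int_commute)
    ultimately have WU3: "3 \<le> card (W - U)" by simp
    obtain x y z where xyz: "{x, y, z} \<subseteq> U - W" "x \<noteq> y" "x \<noteq> z" "y \<noteq> z"
      using obtain_three_distinct[OF UW3] .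
    obtain a b c where abc: "{a, b, c} \<subseteq> W - U" "a \<noteq> b" "a \<noteq> c" "b \<noteq> c"
      using obtain_three_distinct[OF WU3] .
    define T where "T = U - {x, y, z}"
    have UT: "U = T \<union> {x, y, z}"
      using xyz by (auto simp: T_def)
    have "finite T" using fin by (simp add: T_def)
    have kT: "k = card T + 3"
      using xyz \<open>finite T\<close> by (simp add: Uk[symmetric] UT) (simp add: T_def)
    let ?d = "\<lambda>u v w. card (induced_edges E (T \<union> {u, v, w}))"
    \<comment> \<open>Every nontrivial exchange lies closer to \<open>W\<close> than \<open>U\<close> does.\<close>
    have odd: "odd (?d u v w)"
      if "u \<in> {x, a}" "v \<in> {y, b}" "w \<in> {z, c}" and new: "u = a \<or> v = b \<or> w = c" for u v w
    proof -
      let ?S = "T \<union> {u, v, w}"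
      have "u \<notin> T" "v \<notin> T" "w \<notin> T" "u \<noteq> v" "u \<noteq> w" "v \<noteq> w"
        using that xyz abc by (auto simp: T_def)
      then have "card ?S = k"
        using \<open>finite T\<close> by (simp add: kT)
      moreover have "?S \<subseteq> V"
        using that xyz abc UV W by (auto simp: T_def)
      moreover have "?S - W \<subset> U - W"
      proof (rule psubsetI)
        show "?S - W \<subseteq> U - W"
          using that(1-3) xyz(1) abc(1) unfolding T_def by blast
        have "x \<notin> ?S \<or> y \<notin> ?S \<or> z \<notin> ?S"
          using new
        proof (elim disjE)
          assume "u = a"
          then have "x \<notin> ?S" using that(2,3) xyz abc(1) unfolding T_def by blast
          then show ?thesis by blast
        next
          assume "v = b"
          then have "y \<notin> ?S" using that(1,3) xyz abc(1) unfolding T_def by blast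
          then show ?thesis by blast
        next
          assume "w = c"
          then have "z \<notin> ?S" using that(1,2) xyz abc(1) unfolding T_def by blast
          then show ?thesis by blast
        qed
        then show "?S - W \<noteq> U - W"
          using xyz(1) by blast
      qed
      then have "card (?S - W) < card (U - W)"
        using fin by (simp add: psubset_card_mono)
      then have "?S \<notin> even_subgraphs V E k"
        using least by (meson not_le)
      ultimately show ?thesis
        by (simp add: even_subgraphs_def)
    qed
    have "{x, a} \<inter> {y, b} = {}" "{x, a} \<inter> {z, c} = {}" "{y, b} \<inter> {z, c} = {}"
      using xyz abc by auto
    then have "even (?d x y z + ?d a y z + ?d x b z + ?d x y c
                     + ?d a b z + ?d a y c + ?d x b c + ?d a b c)"
      by (intro even_third_difference \<open>finite E\<close> card2)
    moreover have "even (?d x y z)"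
      using Ue UT by simp
    moreover have "odd (?d a y z)" "odd (?d x b z)" "odd (?d x y c)"
      "odd (?d a b z)" "odd (?d a y c)" "odd (?d x b c)" "odd (?d a b c)"
      by (rule odd; simp)+
    ultimately show False
      by (simp only: even_add simp_thms)
  qed
  with U that show thesis by blast
qed

text \<open>
  Coincidences such as \<open>x = y\<close> and \<open>p = q\<close> cover the exchange of fewer than two vertices (and
  \<open>U \<noteq> {}\<close> provides the dummy vertex if \<open>W = U\<close>). A single parametrisation by quadruples thus
  suffices for counting the sets near \<open>U\<close>.
\<close>

lemma exchange_two_vertices:
  assumes "finite U" "finite W" "card U = card W" "U \<noteq> {}" "card (U - W) \<le> 2"
  obtains x y p q where "x \<in> U" "y \<in> U" "p \<in> W" "q \<in> W" "W = U - {x, y} \<union> {p, q}"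
proof -
  have same: "card (W - U) = card (U - W)"
    using assms by (simp add: card_Diff_subset_Int Int_commute)
  consider "card (U - W) = 0" | "card (U - W) = 1" | "card (U - W) = 2"
    using assms(5) by linarith
  then show thesis
  proof cases
    case 1
    then have "U - W = {}" "W - U = {}"
      using same assms(1,2) by (metis card_0_eq finite_Diff)+
    then have "U = W" by blast
    then show thesis
      using that \<open>U \<noteq> {}\<close> by blast
  next
    case 2
    then obtain x p where "U - W = {x}" "W - U = {p}"
      using same by (metis card_1_singletonE)
    then show thesis
      by (intro that[of x x p p]) blast+
  next
    case 3
    then obtain x y p q where "U - W = {x, y}" "W - U = {p, q}"
      using same by (metis card_2_iff)
    then show thesis
      by (intro that[of x y p q]) blast+
  qed
qed

text \<open>
  Every \<open>k\<close>-set comes from an even \<open>U\<close> and a quadruple in \<open>(U \<times> U) \<times> (V \<times> V)\<close>, so a union bound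
  over the even \<open>k\<close>-sets counts all \<open>k\<close>-sets.
\<close>

lemma binomial_le_card_even_subgraphs:
  assumes G: "finite_simple_graph V E"
    and ne: "even_subgraphs V E k \<noteq> {}"
    and "k > 0"
  shows "card V choose k \<le> card (even_subgraphs V E k) * (k\<^sup>2 * (card V)\<^sup>2)"
proof -
  have "finite V"
    using G by (simp add: finite_simple_graph_def)
  then have fin: "finite (even_subgraphs V E k)"
    by (auto simp: even_subgraphs_def intro: finite_subset[of _ "Pow V"])
  define choices where "choices U = (U \<times> U) \<times> (V \<times> V)" for U :: "'a set"
  define swap :: "'a set \<Rightarrow> ('a \<times> 'a) \<times> ('a \<times> 'a) \<Rightarrow> 'a set"
    where "swap = (\<lambda>U ((x, y), (p, q)). U - {x, y} \<union> {p, q})"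
  have evD: "finite U" "U \<subseteq> V" "card U = k" "U \<noteq> {}" if "U \<in> even_subgraphs V E k" for U
    using that \<open>finite V\<close> \<open>k > 0\<close> by (auto simp: even_subgraphs_def intro: finite_subset)
  have "{W. W \<subseteq> V \<and> card W = k} \<subseteq> (\<Union>U\<in>even_subgraphs V E k. swap U ` choices U)"
  proof
    fix W assume "W \<in> {W. W \<subseteq> V \<and> card W = k}"
    then have W: "W \<subseteq> V" "card W = k" by auto
    obtain U where U: "U \<in> even_subgraphs V E k" "card (U - W) \<le> 2"
      using even_subgraph_near[OF G ne W] .
    have "finite W" using W \<open>finite V\<close> finite_subset by blast
    then obtain x y p q where
      "x \<in> U" "y \<in> U" "p \<in> W" "q \<in> W" and eq: "W = U - {x, y} \<union> {p, q}"
      using exchange_two_vertices[of U W] evD[OF U(1)] U(2) W(2) by metis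
    then have "((x, y), (p, q)) \<in> choices U" "W = swap U ((x, y), (p, q))"
      using W(1) by (auto simp: choices_def swap_def)
    then show "W \<in> (\<Union>U\<in>even_subgraphs V E k. swap U ` choices U)"
      using U(1) by blast
  qed
  moreover have finite_choices: "finite (choices U)" if "U \<in> even_subgraphs V E k" for U
    using evD[OF that] \<open>finite V\<close> by (simp add: choices_def)
  ultimately have "card {W. W \<subseteq> V \<and> card W = k}
      \<le> card (\<Union>U\<in>even_subgraphs V E k. swap U ` choices U)"
    using fin by (intro card_mono) auto
  also have "\<dots> \<le> (\<Sum>U\<in>even_subgraphs V E k. card (swap U ` choices U))"
    using fin by (rule card_UN_le)
  also have "\<dots> \<le> (\<Sum>U\<in>even_subgraphs V E k. k\<^sup>2 * (card V)\<^sup>2)"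
  proof (rule sum_mono)
    fix U assume U: "U \<in> even_subgraphs V E k"
    have "card (swap U ` choices U) \<le> card (choices U)"
      using finite_choices[OF U] by (rule card_image_le)
    also have "\<dots> = k\<^sup>2 * (card V)\<^sup>2"
      using evD[OF U] by (simp add: choices_def card_cartesian_product power2_eq_square)
    finally show "card (swap U ` choices U) \<le> k\<^sup>2 * (card V)\<^sup>2" .
  qed
  finally show ?thesis
    using n_subsets[OF \<open>finite V\<close>] by simp
qed

theorem theorem3p10:
  fixes V :: "'a set" and E :: "'a set set" and k n :: nat
  assumes "finite_simple_graph V E"
    and "card V = n"
    and "k \<ge> 3"
    and "n \<ge> 2 ^ (2 * k)"
  shows "even_subgraphs V E k = {} \<or>
         real (card (even_subgraphs V E k)) \<ge>
           1 / (2 ^ (2 * k\<^sup>2 + 1) * (real k)\<^sup>2 * (real n)\<^sup>2) * real (n choose k)"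
  unfolding disj_imp
proof
  assume ne: "even_subgraphs V E k \<noteq> {}"
  let ?N = "real (card (even_subgraphs V E k))" and ?P = "(2::real) ^ (2 * k\<^sup>2 + 1)"
  have "(0::nat) < 2 ^ (2 * k)" by simp
  then have "n > 0" using assms(4) by linarith
  have "n choose k \<le> card (even_subgraphs V E k) * (k\<^sup>2 * n\<^sup>2)"
    using binomial_le_card_even_subgraphs[OF assms(1) ne] assms(2,3) by simp
  then have "real (n choose k) \<le> ?N * ((real k)\<^sup>2 * (real n)\<^sup>2)"
    by (metis of_nat_le_iff of_nat_mult of_nat_power)
  also have "\<dots> \<le> ?N * (?P * ((real k)\<^sup>2 * (real n)\<^sup>2))"
  proof (intro mult_left_mono)
    have "1 * ((real k)\<^sup>2 * (real n)\<^sup>2) \<le> ?P * ((real k)\<^sup>2 * (real n)\<^sup>2)"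
      by (intro mult_right_mono one_le_power) simp_all
    then show "(real k)\<^sup>2 * (real n)\<^sup>2 \<le> ?P * ((real k)\<^sup>2 * (real n)\<^sup>2)" by simp
  qed simp
  finally have "real (n choose k) \<le> ?N * (?P * (real k)\<^sup>2 * (real n)\<^sup>2)"
    by (simp only: mult.assoc)
  moreover have "?P * (real k)\<^sup>2 * (real n)\<^sup>2 > 0"
    using \<open>n > 0\<close> assms(3) by simp
  ultimately show "?N \<ge> 1 / (?P * (real k)\<^sup>2 * (real n)\<^sup>2) * real (n choose k)"
    by (simp only: times_divide_eq_left mult_1 pos_divide_le_eq)
qed

end
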